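(* Let $\varphi$ be a universal first-order sentence in the language $\{+,0,\delta\}$ of contact semilattices. Consider the following conditions on a semilattice with a binary relation $\delta$. (D1) For every $a,b,c_0,c_1$, if $b\le a+c_0$, $b\le a+c_1$ and not $c_0\mathrel{\delta}c_1$, then $b\le a$. (D2) For every $n\in\mathbb N$ (including $n=0$) and all $a,b,c_{1,0},c_{1,1},\dots,c_{n,0},c_{n,1}$: if $c_{i,0}\mathrel{\delta}c_{i,1}$ fails for every $i=1,\dots,n$, and if, for every function $f:\{1,\dots,n\}\to\{0,1\}$, either $b\le c_{1,f(1)}+\dots+c_{n,f(n)}$ or $a\le c_{1,f(1)}+\dots+c_{n,f(n)}$, then $b\mathrel{\delta}a$ fails. (An empty sum is evaluated to $0$.) Then the following conditions (1)-(3) are equivalent. (1) $\varphi$ is a logical consequence of the theory of Boolean algebras with an overlap contact relation. (2) $\varphi$ is a logical consequence of the theory of distributive lattices with an additive contact relation. (3) $\varphi$ is a logical consequence of (D1) and (D2), together with the axioms of join semilattices with $0$. Moreover, the following conditions (4)-(6) are equivalent. (4) $\varphi$ is a logical consequence of the theory of Boolean algebras with a weak contact relation. (5) $\varphi$ is a logical consequence of the theory of distributive lattices with a weak contact relation. (6) $\varphi$ is a logical consequence of (D1), together with the axioms of weak contact semilattices.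
   Context: Semilattices are join semilattices with a minimum element $0$; the operation is written $+$ and the order is $a\le b$ iff $a+b=b$ (so $\le$ is expressible in the language by an atomic formula). Distributive lattices are also assumed to have a minimum $0$. In Boolean algebras and distributive lattices, $+$ is interpreted as join and $0$ as the minimum. (D1) is expressible as a universal sentence and (D2) as a countable set of universal sentences (one for each $n$). A weak contact relation on a poset with $0$ (in particular on a semilattice, distributive lattice or Boolean algebra, with its order) is a binary relation $\delta$ such that, for all elements: (Sym) $a\mathrel{\delta}b$ iff $b\mathrel{\delta}a$; (Emp) $a\mathrel{\delta}b$ implies $a>0$ and $b>0$; (Ext) $a\mathrel{\delta}b$, $a\le a_1$ and $b\le b_1$ imply $a_1\mathrel{\delta}b_1$; (Ref) $n\ne0$ implies $n\mathrel{\delta}n$. A weak contact semilattice is a structure $(S,+,0,\delta)$ where $(S,+,0)$ is a semilattice with $0$ and $\delta$ is a weak contact relation on it. An additive contact relation is a weak contact relation such that moreover $a\mathrel{\delta}b+c$ implies $a\mathrel{\delta}b$ or $a\mathrel{\delta}c$. The overlap contact relation is defined by: $a\mathrel{\delta}b$ iff there is $n>0$ with $n\le a$ and $n\le b$. $\varphi$ is a logical consequence of a theory if it holds in every model of the theory. *)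

theory Defs
  imports "HOL-Algebra.Lattice"
begin

datatype ctm = Var nat | Zero | Plus ctm ctm

datatype cfm =
    Eq ctm ctm
  | Contact ctm ctm
  | Neg cfm
  | Conj cfm cfm
  | Disj cfm cfm
  | Imp cfm cfm
  | All nat cfm
  | Ex nat cfm

primrec tm_vars :: "ctm \<Rightarrow> nat set" where
  "tm_vars (Var v) = {v}"
| "tm_vars Zero = {}"
| "tm_vars (Plus s t) = tm_vars s \<union> tm_vars t"

primrec free_vars :: "cfm \<Rightarrow> nat set" where
  "free_vars (Eq s t) = tm_vars s \<union> tm_vars t"
| "free_vars (Contact s t) = tm_vars s \<union> tm_vars t"
| "free_vars (Neg p) = free_vars p"
| "free_vars (Conj p q) = free_vars p \<union> free_vars q"
| "free_vars (Disj p q) = free_vars p \<union> free_vars q"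
| "free_vars (Imp p q) = free_vars p \<union> free_vars q"
| "free_vars (All v p) = free_vars p - {v}"
| "free_vars (Ex v p) = free_vars p - {v}"

primrec quantifier_free :: "cfm \<Rightarrow> bool" where
  "quantifier_free (Eq s t) = True"
| "quantifier_free (Contact s t) = True"
| "quantifier_free (Neg p) = quantifier_free p"
| "quantifier_free (Conj p q) = (quantifier_free p \<and> quantifier_free q)"
| "quantifier_free (Disj p q) = (quantifier_free p \<and> quantifier_free q)"
| "quantifier_free (Imp p q) = (quantifier_free p \<and> quantifier_free q)"
| "quantifier_free (All v p) = False"
| "quantifier_free (Ex v p) = False"

inductive universal :: "cfm \<Rightarrow> bool" where
  "quantifier_free p \<Longrightarrow> universal p"
| "universal p \<Longrightarrow> universal (All v p)"

definition universal_sentence :: "cfm \<Rightarrow> bool" where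
  "universal_sentence p \<longleftrightarrow> universal p \<and> free_vars p = {}"

record 'a contact_structure = "'a partial_object" +
  cplus :: "'a \<Rightarrow> 'a \<Rightarrow> 'a" (infixl \<open>\<oplus>\<index>\<close> 65)
  czero :: "'a" (\<open>\<zero>\<index>\<close>)
  contact :: "'a \<Rightarrow> 'a \<Rightarrow> bool" (infixl \<open>\<delta>\<index>\<close> 50)

primrec tm_val :: "'a contact_structure \<Rightarrow> (nat \<Rightarrow> 'a) \<Rightarrow> ctm \<Rightarrow> 'a" where
  "tm_val M e (Var v) = e v"
| "tm_val M e Zero = \<zero>\<^bsub>M\<^esub>"
| "tm_val M e (Plus s t) = tm_val M e s \<oplus>\<^bsub>M\<^esub> tm_val M e t"

primrec sat :: "'a contact_structure \<Rightarrow> (nat \<Rightarrow> 'a) \<Rightarrow> cfm \<Rightarrow> bool" where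
  "sat M e (Eq s t) \<longleftrightarrow> tm_val M e s = tm_val M e t"
| "sat M e (Contact s t) \<longleftrightarrow> tm_val M e s \<delta>\<^bsub>M\<^esub> tm_val M e t"
| "sat M e (Neg p) \<longleftrightarrow> \<not> sat M e p"
| "sat M e (Conj p q) \<longleftrightarrow> sat M e p \<and> sat M e q"
| "sat M e (Disj p q) \<longleftrightarrow> sat M e p \<or> sat M e q"
| "sat M e (Imp p q) \<longleftrightarrow> (sat M e p \<longrightarrow> sat M e q)"
| "sat M e (All v p) \<longleftrightarrow> (\<forall>x\<in>carrier M. sat M (e(v := x)) p)"
| "sat M e (Ex v p) \<longleftrightarrow> (\<exists>x\<in>carrier M. sat M (e(v := x)) p)"

definition holds_in :: "'a contact_structure \<Rightarrow> cfm \<Rightarrow> bool" where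
  "holds_in M p \<longleftrightarrow> (\<forall>e. range e \<subseteq> carrier M \<longrightarrow> sat M e p)"

text \<open>
  A theory is given by its class of models. The carriers of the models are arbitrary subsets of
  the type \<open>'a\<close>; HOL cannot quantify over all types inside a formula, so the type is a parameter
  of the notion of logical consequence. It should be instantiated to an infinite type: a small
  finite one has too few models.
\<close>

definition logical_consequence :: "('a contact_structure \<Rightarrow> bool) \<Rightarrow> cfm \<Rightarrow> bool" where
  "logical_consequence T p \<longleftrightarrow> (\<forall>M. T M \<longrightarrow> holds_in M p)"

locale zero_semilattice =
  fixes M :: "'a contact_structure" (structure)
  assumes plus_closed: "\<lbrakk>a \<in> carrier M; b \<in> carrier M\<rbrakk> \<Longrightarrow> a \<oplus> b \<in> carrier M"
    and zero_closed: "\<zero> \<in> carrier M"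
    and plus_assoc: "\<lbrakk>a \<in> carrier M; b \<in> carrier M; c \<in> carrier M\<rbrakk> \<Longrightarrow> (a \<oplus> b) \<oplus> c = a \<oplus> (b \<oplus> c)"
    and plus_comm: "\<lbrakk>a \<in> carrier M; b \<in> carrier M\<rbrakk> \<Longrightarrow> a \<oplus> b = b \<oplus> a"
    and plus_idem: "a \<in> carrier M \<Longrightarrow> a \<oplus> a = a"
    and zero_plus: "a \<in> carrier M \<Longrightarrow> \<zero> \<oplus> a = a"

definition order_of :: "'a contact_structure \<Rightarrow> 'a gorder" where
  "order_of M = \<lparr>carrier = carrier M, eq = (=), le = (\<lambda>a b. a \<oplus>\<^bsub>M\<^esub> b = b)\<rparr>"

abbreviation sle :: "'a contact_structure \<Rightarrow> 'a \<Rightarrow> 'a \<Rightarrow> bool" (\<open>(_/ \<preceq>\<index> _)\<close> [51, 51] 50) where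
  "a \<preceq>\<^bsub>M\<^esub> b \<equiv> a \<sqsubseteq>\<^bsub>order_of M\<^esub> b"

abbreviation sless :: "'a contact_structure \<Rightarrow> 'a \<Rightarrow> 'a \<Rightarrow> bool" (\<open>(_/ \<prec>\<index> _)\<close> [51, 51] 50) where
  "a \<prec>\<^bsub>M\<^esub> b \<equiv> a \<sqsubset>\<^bsub>order_of M\<^esub> b"

text \<open>
  Meets, top and complements are not part of the signature; they are determined by the order.
  The one-element Boolean algebra is allowed.
\<close>

locale zero_distributive_lattice = zero_semilattice +
  assumes lattice_order: "lattice (order_of M)"
    and meet_distrib: "\<lbrakk>a \<in> carrier M; b \<in> carrier M; c \<in> carrier M\<rbrakk> \<Longrightarrow>
      a \<sqinter>\<^bsub>order_of M\<^esub> (b \<oplus> c) = (a \<sqinter>\<^bsub>order_of M\<^esub> b) \<oplus> (a \<sqinter>\<^bsub>order_of M\<^esub> c)"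

locale boolean_algebra_structure = zero_distributive_lattice +
  assumes bounded_order: "bounded_lattice (order_of M)"
    and complement_exists: "a \<in> carrier M \<Longrightarrow>
      \<exists>b\<in>carrier M. a \<sqinter>\<^bsub>order_of M\<^esub> b = \<zero> \<and> a \<oplus> b = \<top>\<^bsub>order_of M\<^esub>"

locale weak_contact =
  fixes M :: "'a contact_structure" (structure)
  assumes Sym: "\<lbrakk>a \<in> carrier M; b \<in> carrier M\<rbrakk> \<Longrightarrow> a \<delta> b \<longleftrightarrow> b \<delta> a"
    and Emp: "\<lbrakk>a \<in> carrier M; b \<in> carrier M; a \<delta> b\<rbrakk> \<Longrightarrow> \<zero> \<prec> a \<and> \<zero> \<prec> b"
    and Ext: "\<lbrakk>a \<in> carrier M; b \<in> carrier M; a1 \<in> carrier M; b1 \<in> carrier M;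
      a \<delta> b; a \<preceq> a1; b \<preceq> b1\<rbrakk> \<Longrightarrow> a1 \<delta> b1"
    and Ref: "\<lbrakk>n \<in> carrier M; n \<noteq> \<zero>\<rbrakk> \<Longrightarrow> n \<delta> n"

locale additive_contact = weak_contact +
  assumes Add: "\<lbrakk>a \<in> carrier M; b \<in> carrier M; c \<in> carrier M; a \<delta> (b \<oplus> c)\<rbrakk> \<Longrightarrow> a \<delta> b \<or> a \<delta> c"

locale overlap_contact =
  fixes M :: "'a contact_structure" (structure)
  assumes overlap: "\<lbrakk>a \<in> carrier M; b \<in> carrier M\<rbrakk> \<Longrightarrow>
    a \<delta> b \<longleftrightarrow> (\<exists>n\<in>carrier M. \<zero> \<prec> n \<and> n \<preceq> a \<and> n \<preceq> b)"

definition D1 :: "'a contact_structure \<Rightarrow> bool" where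
  "D1 M \<longleftrightarrow> (\<forall>a\<in>carrier M. \<forall>b\<in>carrier M. \<forall>c0\<in>carrier M. \<forall>c1\<in>carrier M.
     b \<preceq>\<^bsub>M\<^esub> a \<oplus>\<^bsub>M\<^esub> c0 \<and> b \<preceq>\<^bsub>M\<^esub> a \<oplus>\<^bsub>M\<^esub> c1 \<and> \<not> c0 \<delta>\<^bsub>M\<^esub> c1 \<longrightarrow> b \<preceq>\<^bsub>M\<^esub> a)"

primrec plus_upto :: "'a contact_structure \<Rightarrow> (nat \<Rightarrow> 'a) \<Rightarrow> nat \<Rightarrow> 'a" where
  "plus_upto M g 0 = \<zero>\<^bsub>M\<^esub>"
| "plus_upto M g (Suc n) = plus_upto M g n \<oplus>\<^bsub>M\<^esub> g (Suc n)"

definition D2 :: "'a contact_structure \<Rightarrow> bool" where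
  "D2 M \<longleftrightarrow> (\<forall>n::nat. \<forall>a\<in>carrier M. \<forall>b\<in>carrier M. \<forall>c::nat \<Rightarrow> nat \<Rightarrow> 'a.
     (\<forall>i\<in>{1..n}. \<forall>j\<in>{0,1}. c i j \<in> carrier M) \<longrightarrow>
     (\<forall>i\<in>{1..n}. \<not> c i 0 \<delta>\<^bsub>M\<^esub> c i 1) \<longrightarrow>
     (\<forall>f\<in>{1..n} \<rightarrow> {0,1::nat}.
        b \<preceq>\<^bsub>M\<^esub> plus_upto M (\<lambda>i. c i (f i)) n \<or> a \<preceq>\<^bsub>M\<^esub> plus_upto M (\<lambda>i. c i (f i)) n) \<longrightarrow>
     \<not> b \<delta>\<^bsub>M\<^esub> a)"

definition BA_overlap :: "'a contact_structure \<Rightarrow> bool" where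
  "BA_overlap M \<longleftrightarrow> boolean_algebra_structure M \<and> overlap_contact M"

definition DL_additive :: "'a contact_structure \<Rightarrow> bool" where
  "DL_additive M \<longleftrightarrow> zero_distributive_lattice M \<and> additive_contact M"

definition SL_D1_D2 :: "'a contact_structure \<Rightarrow> bool" where
  "SL_D1_D2 M \<longleftrightarrow> zero_semilattice M \<and> D1 M \<and> D2 M"

definition BA_weak :: "'a contact_structure \<Rightarrow> bool" where
  "BA_weak M \<longleftrightarrow> boolean_algebra_structure M \<and> weak_contact M"

definition DL_weak :: "'a contact_structure \<Rightarrow> bool" where
  "DL_weak M \<longleftrightarrow> zero_distributive_lattice M \<and> weak_contact M"

definition SL_weak_D1 :: "'a contact_structure \<Rightarrow> bool" where
  "SL_weak_D1 M \<longleftrightarrow> zero_semilattice M \<and> weak_contact M \<and> D1 M"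

end

theory Submission
  imports Defs
begin

text \<open>
  A universal sentence that fails in a semilattice fails already in a finite subsemilattice, because
  semilattices are locally finite and a counterexample to the quantifier-free matrix involves
  finitely many elements. (D1), (D2) and the axioms of weak contact pass to subsemilattices. What
  remains is a representation of finite structures: a finite semilattice with (D1) and (D2) embeds
  into the powerset of a finite set of points, with contact becoming intersection. The points are
  the (principal) ideals that contain a member of each pair of elements not in contact. (D1) provides
  enough points to separate elements (\<open>le_if_rep_subset\<close>), and (D2) provides a point common to any
  two elements in contact (\<open>rep_intersect_if_contact\<close>). For a weak contact relation (D2) is lost,
  and one enlarges the overlap relation of the powerset by the image of the given contact relation
  (\<open>consequence_SL_weak_D1_if_BA_weak\<close>).

  Conversely, every distributive lattice with a weak contact relation satisfies (D1), and additivity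
  of the relation gives (D2) (\<open>D2_if_additive_contact\<close>). So each of the two groups of theories is a
  cycle: the classes of models grow from Boolean algebras to semilattices, and the sentences refuted
  in the largest class are refuted in the smallest one.

  The refuting Boolean algebra is finite, so it has copies on subsets of every infinite type. This
  makes the classes comparable although their models live on different types.
\<close>

section \<open>Semilattices, their substructures and local finiteness\<close>

lemma carrier_order_of [simp]: "carrier (order_of M) = carrier M"
  by (simp add: order_of_def)

lemma eq_order_of [simp]: "eq (order_of M) = (=)"
  by (simp add: order_of_def)

lemma le_order_of: "a \<preceq>\<^bsub>M\<^esub> b \<longleftrightarrow> a \<oplus>\<^bsub>M\<^esub> b = b"
  by (simp add: order_of_def)

lemma less_order_of: "a \<prec>\<^bsub>M\<^esub> b \<longleftrightarrow> a \<preceq>\<^bsub>M\<^esub> b \<and> a \<noteq> b"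
  by (simp add: lless_def)

context zero_semilattice
begin

lemma le_refl: "a \<in> carrier M \<Longrightarrow> a \<preceq> a"
  by (simp add: le_order_of plus_idem)

lemma le_trans:
  "\<lbrakk>a \<preceq> b; b \<preceq> c; a \<in> carrier M; b \<in> carrier M; c \<in> carrier M\<rbrakk> \<Longrightarrow> a \<preceq> c"
  unfolding le_order_of by (metis plus_assoc)

lemma le_antisym: "\<lbrakk>a \<preceq> b; b \<preceq> a; a \<in> carrier M; b \<in> carrier M\<rbrakk> \<Longrightarrow> a = b"
  unfolding le_order_of by (metis plus_comm)

lemma le_plus_left: "\<lbrakk>a \<in> carrier M; b \<in> carrier M\<rbrakk> \<Longrightarrow> a \<preceq> a \<oplus> b"
  unfolding le_order_of by (metis plus_assoc plus_idem)

lemma le_plus_right: "\<lbrakk>a \<in> carrier M; b \<in> carrier M\<rbrakk> \<Longrightarrow> b \<preceq> a \<oplus> b"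
  using le_plus_left[of b a] by (simp add: plus_comm)

lemma plus_least:
  "\<lbrakk>a \<preceq> c; b \<preceq> c; a \<in> carrier M; b \<in> carrier M; c \<in> carrier M\<rbrakk> \<Longrightarrow> a \<oplus> b \<preceq> c"
  unfolding le_order_of by (metis plus_assoc)

lemma plus_le_iff:
  assumes "a \<in> carrier M" "b \<in> carrier M" "c \<in> carrier M"
  shows "a \<oplus> b \<preceq> c \<longleftrightarrow> a \<preceq> c \<and> b \<preceq> c"
  using assms le_plus_left le_plus_right plus_least le_trans plus_closed by metis

lemma zero_le: "a \<in> carrier M \<Longrightarrow> \<zero> \<preceq> a"
  by (simp add: le_order_of zero_plus)

lemma le_zero_iff: "a \<in> carrier M \<Longrightarrow> a \<preceq> \<zero> \<longleftrightarrow> a = \<zero>"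
  using le_antisym zero_le zero_closed le_refl by metis

lemma plus_upto_closed:
  "(\<And>i. i \<in> {1..n} \<Longrightarrow> g i \<in> carrier M) \<Longrightarrow> plus_upto M g n \<in> carrier M"
  by (induction n) (auto simp: zero_closed plus_closed)

lemma le_plus_upto:
  "(\<And>i. i \<in> {1..n} \<Longrightarrow> g i \<in> carrier M) \<Longrightarrow> i \<in> {1..n} \<Longrightarrow> g i \<preceq> plus_upto M g n"
proof (induction n)
  case (Suc n)
  have cl: "plus_upto M g n \<in> carrier M"
    using Suc.prems(1) by (intro plus_upto_closed) auto
  have gS: "g (Suc n) \<in> carrier M" and gi: "g i \<in> carrier M"
    using Suc.prems by auto
  show ?case
  proof (cases "i = Suc n")
    case True
    then show ?thesis using le_plus_right[OF cl gS] by simp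
  next
    case False
    then have "g i \<preceq> plus_upto M g n" using Suc by auto
    then show ?thesis
      using le_trans[OF _ le_plus_left[OF cl gS]] gi cl gS plus_closed by auto
  qed
qed simp

end

lemma plus_upto_restrict [simp]: "plus_upto (M\<lparr>carrier := S\<rparr>) g n = plus_upto M g n"
  by (induction n) auto

lemma le_restrict [simp]: "a \<preceq>\<^bsub>M\<lparr>carrier := S\<rparr>\<^esub> b \<longleftrightarrow> a \<preceq>\<^bsub>M\<^esub> b"
  by (simp add: le_order_of)

lemma less_restrict [simp]: "a \<prec>\<^bsub>M\<lparr>carrier := S\<rparr>\<^esub> b \<longleftrightarrow> a \<prec>\<^bsub>M\<^esub> b"
  by (simp add: less_order_of)

lemma D1_restrict: "D1 M \<Longrightarrow> S \<subseteq> carrier M \<Longrightarrow> D1 (M\<lparr>carrier := S\<rparr>)"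
  unfolding D1_def le_restrict by (simp add: subset_iff) blast

lemma D2_restrict:
  assumes "D2 M" "S \<subseteq> carrier M"
  shows "D2 (M\<lparr>carrier := S\<rparr>)"
  unfolding D2_def
proof (intro allI ballI impI)
  fix n :: nat and a b and c :: "nat \<Rightarrow> nat \<Rightarrow> 'a"
  let ?N = "M\<lparr>carrier := S\<rparr>"
  assume ab: "a \<in> carrier ?N" "b \<in> carrier ?N"
    and c: "\<forall>i\<in>{1..n}. \<forall>j\<in>{0,1}. c i j \<in> carrier ?N"
    and nd: "\<forall>i\<in>{1..n}. \<not> c i 0 \<delta>\<^bsub>?N\<^esub> c i 1"
    and f: "\<forall>f\<in>{1..n} \<rightarrow> {0,1::nat}. b \<preceq>\<^bsub>?N\<^esub> plus_upto ?N (\<lambda>i. c i (f i)) n \<or>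
       a \<preceq>\<^bsub>?N\<^esub> plus_upto ?N (\<lambda>i. c i (f i)) n"
  have 1: "a \<in> carrier M" "b \<in> carrier M" using ab assms(2) by auto
  have 2: "\<forall>i\<in>{1..n}. \<forall>j\<in>{0,1}. c i j \<in> carrier M" using c assms(2) by auto
  have 3: "\<forall>i\<in>{1..n}. \<not> c i 0 \<delta>\<^bsub>M\<^esub> c i 1" using nd by simp
  have 4: "\<forall>f\<in>{1..n} \<rightarrow> {0,1::nat}. b \<preceq>\<^bsub>M\<^esub> plus_upto M (\<lambda>i. c i (f i)) n \<or>
       a \<preceq>\<^bsub>M\<^esub> plus_upto M (\<lambda>i. c i (f i)) n"
    using f unfolding le_restrict plus_upto_restrict .
  show "\<not> b \<delta>\<^bsub>?N\<^esub> a"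
    using assms(1)[unfolded D2_def, rule_format, OF 1, of n c] 2 3 4 by simp
qed

lemma weak_contact_restrict:
  assumes "weak_contact M" "S \<subseteq> carrier M"
  shows "weak_contact (M\<lparr>carrier := S\<rparr>)"
proof -
  interpret weak_contact M by fact
  show ?thesis
  proof (unfold_locales, goal_cases)
    case (1 a b) then show ?case using Sym[of a b] assms(2) by auto
  next
    case (2 a b) then show ?case using Emp[of a b] assms(2) by auto
  next
    case (3 a b a1 b1) then show ?case using Ext[of a b a1 b1] assms(2) by auto
  next
    case (4 n) then show ?case using Ref[of n] assms(2) by auto
  qed
qed

text \<open>
  Semilattices are locally finite. When one element \<open>x\<close> is adjoined, every new element is an old one
  or an old one plus \<open>x\<close>, so a finite subsemilattice stays finite.
\<close>

lemma finite_subsemilattice: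
  assumes "zero_semilattice M" "finite F" "F \<subseteq> carrier M"
  shows "\<exists>S. finite S \<and> F \<subseteq> S \<and> S \<subseteq> carrier M \<and> zero_semilattice (M\<lparr>carrier := S\<rparr>)"
  using assms(2,3)
proof (induction F)
  case empty
  interpret zero_semilattice M by fact
  have "zero_semilattice (M\<lparr>carrier := {\<zero>\<^bsub>M\<^esub>}\<rparr>)"
    by unfold_locales (auto simp: zero_plus zero_closed)
  then show ?case using zero_closed by (intro exI[of _ "{\<zero>\<^bsub>M\<^esub>}"]) auto
next
  case (insert x F)
  interpret zero_semilattice M by fact
  obtain S where S: "finite S" "F \<subseteq> S" "S \<subseteq> carrier M" "zero_semilattice (M\<lparr>carrier := S\<rparr>)"
    using insert by auto
  interpret S: zero_semilattice "M\<lparr>carrier := S\<rparr>" by fact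
  have x: "x \<in> carrier M" using insert.prems by simp
  let ?T = "S \<union> (\<lambda>s. s \<oplus>\<^bsub>M\<^esub> x) ` S"
  have z: "\<zero>\<^bsub>M\<^esub> \<in> S" using S.zero_closed by simp
  have cS: "a \<oplus>\<^bsub>M\<^esub> b \<in> S" if "a \<in> S" "b \<in> S" for a b
    using S.plus_closed that by simp
  have sub: "?T \<subseteq> carrier M" using S(3) x plus_closed by auto
  have e1: "(a \<oplus>\<^bsub>M\<^esub> x) \<oplus>\<^bsub>M\<^esub> b = (a \<oplus>\<^bsub>M\<^esub> b) \<oplus>\<^bsub>M\<^esub> x"
    and e2: "a \<oplus>\<^bsub>M\<^esub> (b \<oplus>\<^bsub>M\<^esub> x) = (a \<oplus>\<^bsub>M\<^esub> b) \<oplus>\<^bsub>M\<^esub> x"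
    and e3: "(a \<oplus>\<^bsub>M\<^esub> x) \<oplus>\<^bsub>M\<^esub> (b \<oplus>\<^bsub>M\<^esub> x) = (a \<oplus>\<^bsub>M\<^esub> b) \<oplus>\<^bsub>M\<^esub> x"
    if "a \<in> S" "b \<in> S" for a b
  proof -
    have ab: "a \<in> carrier M" "b \<in> carrier M" using that S(3) by auto
    show 1: "(a \<oplus>\<^bsub>M\<^esub> x) \<oplus>\<^bsub>M\<^esub> b = (a \<oplus>\<^bsub>M\<^esub> b) \<oplus>\<^bsub>M\<^esub> x"
      by (metis ab x plus_assoc plus_comm)
    show 2: "a \<oplus>\<^bsub>M\<^esub> (b \<oplus>\<^bsub>M\<^esub> x) = (a \<oplus>\<^bsub>M\<^esub> b) \<oplus>\<^bsub>M\<^esub> x"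
      by (metis ab x plus_assoc)
    show "(a \<oplus>\<^bsub>M\<^esub> x) \<oplus>\<^bsub>M\<^esub> (b \<oplus>\<^bsub>M\<^esub> x) = (a \<oplus>\<^bsub>M\<^esub> b) \<oplus>\<^bsub>M\<^esub> x"
      by (metis 1 ab x plus_assoc plus_closed plus_idem)
  qed
  have T: "y \<in> carrier M" if "y \<in> carrier (M\<lparr>carrier := ?T\<rparr>)" for y
    using that sub by auto
  have "zero_semilattice (M\<lparr>carrier := ?T\<rparr>)"
  proof (unfold_locales, goal_cases)
    case (1 a b)
    then show ?case using cS by (auto simp: e1 e2 e3)
  next
    case 2
    then show ?case using z by simp
  next
    case (3 a b c)
    show ?case using plus_assoc[OF T[OF 3(1)] T[OF 3(2)] T[OF 3(3)]] by simp
  next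
    case (4 a b)
    show ?case using plus_comm[OF T[OF 4(1)] T[OF 4(2)]] by simp
  next
    case (5 a)
    show ?case using plus_idem[OF T[OF 5]] by simp
  next
    case (6 a)
    show ?case using zero_plus[OF T[OF 6]] by simp
  qed
  moreover have "x \<in> ?T" using z zero_plus[OF x] by force
  ultimately show ?case using S sub by (intro exI[of _ ?T]) auto
qed

section \<open>Finite refutations and embeddings\<close>

text \<open>
  Dropping a universal quantifier does not change whether a formula holds for all assignments.
  The two carrier types are needed because the formula is compared in structures of both.
\<close>

lemma universal_matrix:
  assumes "universal \<phi>"
  obtains p where "quantifier_free p"
    and "\<And>M :: 'a contact_structure. holds_in M \<phi> \<longleftrightarrow> holds_in M p"
    and "\<And>M :: 'b contact_structure. holds_in M \<phi> \<longleftrightarrow> holds_in M p"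
proof -
  have All: "holds_in M (All v q) \<longleftrightarrow> holds_in M q" for M :: "'c contact_structure" and v q
  proof
    assume A: "holds_in M (All v q)"
    show "holds_in M q"
      unfolding holds_in_def
    proof (intro allI impI)
      fix e :: "nat \<Rightarrow> 'c"
      assume e: "range e \<subseteq> carrier M"
      then have "sat M e (All v q)" "e v \<in> carrier M" using A by (auto simp: holds_in_def)
      then have "sat M (e(v := e v)) q" unfolding sat.simps by blast
      then show "sat M e q" by simp
    qed
  next
    assume A: "holds_in M q"
    show "holds_in M (All v q)"
      unfolding holds_in_def
    proof (intro allI impI)
      fix e :: "nat \<Rightarrow> 'c"
      assume e: "range e \<subseteq> carrier M"
      have "range (e(v := x)) \<subseteq> carrier M" if "x \<in> carrier M" for x
        using e that by (auto simp: image_subset_iff)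
      then show "sat M e (All v q)" using A unfolding holds_in_def by auto
    qed
  qed
  have "\<exists>p. quantifier_free p \<and> (\<forall>M :: 'a contact_structure. holds_in M \<phi> \<longleftrightarrow> holds_in M p)
    \<and> (\<forall>M :: 'b contact_structure. holds_in M \<phi> \<longleftrightarrow> holds_in M p)"
    using assms by induction (auto simp: All)
  then show thesis using that by blast
qed

lemma finite_tm_vars: "finite (tm_vars t)"
  by (induction t) auto

lemma finite_free_vars: "finite (free_vars p)"
  by (induction p) (auto simp: finite_tm_vars)

lemma tm_val_restrict_cong:
  "(\<And>v. v \<in> tm_vars t \<Longrightarrow> e v = e' v) \<Longrightarrow> tm_val (M\<lparr>carrier := S\<rparr>) e t = tm_val M e' t"
  by (induction t) auto

lemma sat_restrict_cong:
  "quantifier_free p \<Longrightarrow> (\<And>v. v \<in> free_vars p \<Longrightarrow> e v = e' v) \<Longrightarrow>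
    sat (M\<lparr>carrier := S\<rparr>) e p \<longleftrightarrow> sat M e' p"
proof (induction p)
  case (Eq s t)
  then show ?case using tm_val_restrict_cong[of s e e' S M] tm_val_restrict_cong[of t e e' S M] by simp
next
  case (Contact s t)
  then show ?case using tm_val_restrict_cong[of s e e' S M] tm_val_restrict_cong[of t e e' S M] by simp
qed auto

text \<open>
  A falsifying assignment only matters at the finitely many variables of the formula; by local
  finiteness the values there lie in a finite subsemilattice.
\<close>

lemma finite_refutation:
  assumes "zero_semilattice M" "quantifier_free p" "\<not> holds_in M p"
  obtains S where "finite S" "S \<subseteq> carrier M" "zero_semilattice (M\<lparr>carrier := S\<rparr>)"
    "\<not> holds_in (M\<lparr>carrier := S\<rparr>) p"
proof -
  obtain e where e: "range e \<subseteq> carrier M" "\<not> sat M e p"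
    using assms(3) unfolding holds_in_def by auto
  obtain S where S: "finite S" "e ` free_vars p \<subseteq> S" "S \<subseteq> carrier M"
    "zero_semilattice (M\<lparr>carrier := S\<rparr>)"
    using finite_subsemilattice[OF assms(1), of "e ` free_vars p"] finite_free_vars e(1) by blast
  let ?e = "\<lambda>v. if v \<in> free_vars p then e v else \<zero>\<^bsub>M\<^esub>"
  have "range ?e \<subseteq> S"
    using S(2) zero_semilattice.zero_closed[OF S(4)] by auto
  moreover have "\<not> sat (M\<lparr>carrier := S\<rparr>) ?e p"
    using sat_restrict_cong[OF assms(2), of ?e e S M] e(2) by simp
  ultimately have "\<not> holds_in (M\<lparr>carrier := S\<rparr>) p" unfolding holds_in_def by (intro notI) simp
  then show thesis using S that by blast
qed

locale contact_embedding = zero_semilattice N for N :: "'a contact_structure" +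
  fixes B :: "'b contact_structure" and h :: "'a \<Rightarrow> 'b"
  assumes h_closed: "a \<in> carrier N \<Longrightarrow> h a \<in> carrier B"
    and h_inj: "inj_on h (carrier N)"
    and h_zero: "h \<zero>\<^bsub>N\<^esub> = \<zero>\<^bsub>B\<^esub>"
    and h_plus: "\<lbrakk>a \<in> carrier N; b \<in> carrier N\<rbrakk> \<Longrightarrow> h (a \<oplus>\<^bsub>N\<^esub> b) = h a \<oplus>\<^bsub>B\<^esub> h b"
    and h_contact: "\<lbrakk>a \<in> carrier N; b \<in> carrier N\<rbrakk> \<Longrightarrow> h a \<delta>\<^bsub>B\<^esub> h b \<longleftrightarrow> a \<delta>\<^bsub>N\<^esub> b"
begin

lemma tm_val_closed: "range e \<subseteq> carrier N \<Longrightarrow> tm_val N e t \<in> carrier N"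
  by (induction t) (auto simp: zero_closed plus_closed)

lemma tm_val_embedding: "range e \<subseteq> carrier N \<Longrightarrow> tm_val B (h \<circ> e) t = h (tm_val N e t)"
  by (induction t) (auto simp: h_zero h_plus tm_val_closed)

lemma sat_embedding:
  "quantifier_free p \<Longrightarrow> range e \<subseteq> carrier N \<Longrightarrow> sat B (h \<circ> e) p \<longleftrightarrow> sat N e p"
  by (induction p)
    (auto simp: tm_val_embedding h_contact tm_val_closed inj_on_eq_iff[OF h_inj])

lemma holds_in_embedding:
  assumes "quantifier_free p" "holds_in B p"
  shows "holds_in N p"
  unfolding holds_in_def
proof (intro allI impI)
  fix e :: "nat \<Rightarrow> 'a"
  assume e: "range e \<subseteq> carrier N"
  then have "range (h \<circ> e) \<subseteq> carrier B" using h_closed by auto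
  then show "sat N e p"
    using assms e sat_embedding unfolding holds_in_def by blast
qed

end

section \<open>Contact relations on distributive lattices\<close>

context zero_distributive_lattice
begin

lemma
  assumes "a \<in> carrier M" "b \<in> carrier M"
  shows meet_closed: "a \<sqinter>\<^bsub>order_of M\<^esub> b \<in> carrier M"
    and meet_le_left: "a \<sqinter>\<^bsub>order_of M\<^esub> b \<preceq> a"
    and meet_le_right: "a \<sqinter>\<^bsub>order_of M\<^esub> b \<preceq> b"
proof -
  interpret L: lattice "order_of M" by (rule lattice_order)
  show "a \<sqinter>\<^bsub>order_of M\<^esub> b \<in> carrier M"
    using L.meet_closed assms by simp
  show "a \<sqinter>\<^bsub>order_of M\<^esub> b \<preceq> a" "a \<sqinter>\<^bsub>order_of M\<^esub> b \<preceq> b"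
    using L.meet_left L.meet_right assms by auto
qed

lemma le_meet:
  assumes "c \<preceq> a" "c \<preceq> b" "a \<in> carrier M" "b \<in> carrier M" "c \<in> carrier M"
  shows "c \<preceq> a \<sqinter>\<^bsub>order_of M\<^esub> b"
proof -
  interpret L: lattice "order_of M" by (rule lattice_order)
  show ?thesis using L.meet_le assms by simp
qed

lemma plus_meets_eq:
  assumes "a \<preceq> b \<oplus> c" "a \<in> carrier M" "b \<in> carrier M" "c \<in> carrier M"
  shows "(a \<sqinter>\<^bsub>order_of M\<^esub> b) \<oplus> (a \<sqinter>\<^bsub>order_of M\<^esub> c) = a"
proof -
  have "a \<sqinter>\<^bsub>order_of M\<^esub> (b \<oplus> c) = a"
    using assms by (intro le_antisym le_meet meet_le_left) (auto simp: le_refl plus_closed meet_closed)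
  then show ?thesis using meet_distrib assms by simp
qed

text \<open>A nonzero common lower bound is in contact with itself, and extensionality passes this up.\<close>

lemma zero_if_below_noncontact:
  assumes "weak_contact M" "\<not> c0 \<delta> c1" "x \<preceq> c0" "x \<preceq> c1"
    and "x \<in> carrier M" "c0 \<in> carrier M" "c1 \<in> carrier M"
  shows "x = \<zero>"
  using assms weak_contact.Ref weak_contact.Ext by metis

text \<open>
  If \<open>c0\<close> and \<open>c1\<close> are not in contact, their meet is \<open>\<zero>\<close>, so distributivity makes \<open>a\<close> the meet of
  \<open>a \<oplus> c0\<close> and \<open>a \<oplus> c1\<close>.
\<close>

lemma D1_if_weak_contact:
  assumes "weak_contact M"
  shows "D1 M"
  unfolding D1_def
proof (intro ballI impI, elim conjE)
  fix a b c0 c1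
  assume A: "a \<in> carrier M" "b \<in> carrier M" "c0 \<in> carrier M" "c1 \<in> carrier M"
    and b0: "b \<preceq> a \<oplus> c0" and b1: "b \<preceq> a \<oplus> c1" and nd: "\<not> c0 \<delta> c1"
  let ?x = "b \<sqinter>\<^bsub>order_of M\<^esub> c0"
  have x: "?x \<in> carrier M" "?x \<preceq> b" "?x \<preceq> c0"
    using A meet_closed meet_le_left meet_le_right by auto
  have "?x \<preceq> a \<oplus> c1" using le_trans[OF x(2) b1] A x plus_closed by simp
  then have eq: "(?x \<sqinter>\<^bsub>order_of M\<^esub> a) \<oplus> (?x \<sqinter>\<^bsub>order_of M\<^esub> c1) = ?x"
    using plus_meets_eq A x by simp
  have "?x \<sqinter>\<^bsub>order_of M\<^esub> c1 = \<zero>"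
    using zero_if_below_noncontact[OF assms nd] A x
    by (meson le_trans meet_closed meet_le_left meet_le_right)
  then have "?x = ?x \<sqinter>\<^bsub>order_of M\<^esub> a"
    using eq zero_plus plus_comm zero_closed meet_closed A x by metis
  then have "?x \<preceq> a" using meet_le_right A x by metis
  moreover have "(b \<sqinter>\<^bsub>order_of M\<^esub> a) \<oplus> ?x = b" using plus_meets_eq A b0 by simp
  moreover have "b \<sqinter>\<^bsub>order_of M\<^esub> a \<preceq> a" using meet_le_right A by simp
  ultimately show "b \<preceq> a" using plus_least A x meet_closed by metis
qed

lemma additive_contact_if_overlap:
  assumes "overlap_contact M"
  shows "additive_contact M"
proof -
  interpret overlap_contact M by fact
  show ?thesis
  proof (unfold_locales, goal_cases)
    case (1 a b)
    then show ?case by (auto simp: overlap)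
  next
    case (2 a b)
    then obtain n where "n \<in> carrier M" "\<zero> \<prec> n" "n \<preceq> a" "n \<preceq> b" using overlap by auto
    then show ?case using 2 le_zero_iff zero_le unfolding less_order_of by metis
  next
    case (3 a b a1 b1)
    then obtain n where n: "n \<in> carrier M" "\<zero> \<prec> n" "n \<preceq> a" "n \<preceq> b" using overlap by auto
    then have "n \<preceq> a1" "n \<preceq> b1" using 3 le_trans by blast+
    then show ?case using overlap 3 n by blast
  next
    case (4 n)
    then show ?case unfolding overlap[OF 4(1) 4(1)] less_order_of using zero_le le_refl by metis
  next
    case (5 a b c)
    then obtain n where n: "n \<in> carrier M" "\<zero> \<prec> n" "n \<preceq> a" "n \<preceq> b \<oplus> c"
      using overlap plus_closed by auto
    have eq: "(n \<sqinter>\<^bsub>order_of M\<^esub> b) \<oplus> (n \<sqinter>\<^bsub>order_of M\<^esub> c) = n"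
      using plus_meets_eq n 5 by simp
    have le_a: "n \<sqinter>\<^bsub>order_of M\<^esub> x \<preceq> a" if "x \<in> carrier M" for x
      using le_trans[OF meet_le_left n(3)] meet_closed n 5 that by simp
    have nz: "\<zero> \<prec> x \<longleftrightarrow> x \<noteq> \<zero>" if "x \<in> carrier M" for x
      using that by (auto simp: less_order_of zero_le)
    have "n \<sqinter>\<^bsub>order_of M\<^esub> b \<noteq> \<zero> \<or> n \<sqinter>\<^bsub>order_of M\<^esub> c \<noteq> \<zero>"
      using eq n nz zero_plus zero_closed by metis
    then show ?case
      unfolding overlap[OF 5(1,2)] overlap[OF 5(1,3)]
      using le_a nz meet_closed meet_le_right n 5 by metis
  qed
qed

lemma additive_contact_plus_upto:
  assumes "additive_contact M" "\<And>i. i \<in> {1..n} \<Longrightarrow> g i \<in> carrier M"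
    and "x \<in> carrier M" "a \<in> carrier M" "x \<delta> a" "x \<preceq> plus_upto M g n"
  shows "\<exists>i\<in>{1..n}. \<exists>y\<in>carrier M. y \<preceq> x \<and> y \<preceq> g i \<and> y \<delta> a"
  using assms(2-)
proof (induction n arbitrary: x)
  case 0
  interpret additive_contact M by fact
  have "x = \<zero>" using 0 le_zero_iff by simp
  then show ?case using Emp[of x a] 0 by (simp add: less_order_of)
next
  case (Suc n)
  interpret additive_contact M by fact
  let ?P = "plus_upto M g n"
  have cl: "?P \<in> carrier M" "g (Suc n) \<in> carrier M"
    using Suc.prems(1) by (auto intro: plus_upto_closed)
  define u where "u = x \<sqinter>\<^bsub>order_of M\<^esub> ?P"
  define v where "v = x \<sqinter>\<^bsub>order_of M\<^esub> g (Suc n)"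
  have uv: "u \<in> carrier M" "v \<in> carrier M" "u \<preceq> x" "v \<preceq> x" "u \<preceq> ?P" "v \<preceq> g (Suc n)"
    unfolding u_def v_def using cl Suc.prems meet_closed meet_le_left meet_le_right by auto
  have "u \<oplus> v = x"
    unfolding u_def v_def using plus_meets_eq cl Suc.prems by simp
  then have "u \<delta> a \<or> v \<delta> a"
    using Add[of a u v] Sym uv Suc.prems by metis
  then show ?case
  proof
    assume "v \<delta> a"
    then show ?thesis using uv by (intro bexI[of _ "Suc n"] bexI[of _ v]) auto
  next
    assume "u \<delta> a"
    then obtain i y where "i \<in> {1..n}" "y \<in> carrier M" "y \<preceq> u" "y \<preceq> g i" "y \<delta> a"
      using Suc.IH[of u] Suc.prems uv by auto
    moreover then have "y \<preceq> x" using le_trans uv Suc.prems by blast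
    ultimately show ?thesis by (intro bexI[of _ i] bexI[of _ y]) auto
  qed
qed

text \<open>
  Suppose \<open>b \<delta> a\<close> although every choice function \<open>f\<close> has \<open>b\<close> or \<open>a\<close> below its sum. By additivity,
  \<open>b\<close> and \<open>a\<close> can be shrunk, one choice function after the other, to elements that are still in
  contact and one of which lies below a single summand \<open>c i (f i)\<close> for every \<open>f\<close>. For the shrunk
  pair, however, each \<open>i\<close> has a side \<open>j\<close> with neither element below \<open>c i j\<close>: otherwise the pair,
  or one of its elements with itself, would put \<open>c i 0\<close> and \<open>c i 1\<close> in contact. The function
  picking these sides is a contradiction.
\<close>

lemma D2_if_additive_contact:
  assumes "additive_contact M"
  shows "D2 M"
  unfolding D2_def
proof (intro allI ballI impI notI)
  interpret additive_contact M by fact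
  fix n :: nat and a b and c :: "nat \<Rightarrow> nat \<Rightarrow> 'a"
  assume a: "a \<in> carrier M" and b: "b \<in> carrier M"
    and c': "\<forall>i\<in>{1..n}. \<forall>j\<in>{0,1}. c i j \<in> carrier M"
    and nd: "\<forall>i\<in>{1..n}. \<not> c i 0 \<delta> c i 1"
    and below: "\<forall>f\<in>{1..n} \<rightarrow> {0,1::nat}. b \<preceq> plus_upto M (\<lambda>i. c i (f i)) n \<or>
       a \<preceq> plus_upto M (\<lambda>i. c i (f i)) n"
    and contact: "b \<delta> a"
  have c: "c i j \<in> carrier M" if "i \<in> {1..n}" "j \<in> {0,1}" for i j
    using c' that by blast
  define E where "E = {1..n} \<rightarrow>\<^sub>E {0,1::nat}"
  have "finite E" unfolding E_def by (intro finite_PiE) auto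
  have shrink: "\<exists>y x. y \<in> carrier M \<and> x \<in> carrier M \<and> y \<preceq> b \<and> x \<preceq> a \<and> y \<delta> x \<and>
      (\<forall>f\<in>F. \<exists>i\<in>{1..n}. y \<preceq> c i (f i) \<or> x \<preceq> c i (f i))"
    if "finite F" "F \<subseteq> E" for F
    using that
  proof (induction F)
    case empty
    then show ?case using a b contact le_refl by blast
  next
    case (insert f F)
    then obtain y x where yx: "y \<in> carrier M" "x \<in> carrier M" "y \<preceq> b" "x \<preceq> a" "y \<delta> x"
      and F: "\<forall>f\<in>F. \<exists>i\<in>{1..n}. y \<preceq> c i (f i) \<or> x \<preceq> c i (f i)" by auto
    have f: "f \<in> {1..n} \<rightarrow> {0,1}" using insert.prems unfolding E_def PiE_def by blast
    then have cf: "c i (f i) \<in> carrier M" if "i \<in> {1..n}" for i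
      using c that by (meson Pi_mem)
    let ?s = "plus_upto M (\<lambda>i. c i (f i)) n"
    have s: "?s \<in> carrier M" using cf by (rule plus_upto_closed)
    have keep: "\<exists>i\<in>{1..n}. y' \<preceq> c i (g i) \<or> x' \<preceq> c i (g i)"
      if g: "g \<in> F" and y': "y' \<in> carrier M" "y' \<preceq> y" and x': "x' \<in> carrier M" "x' \<preceq> x" for g y' x'
    proof -
      obtain i where i: "i \<in> {1..n}" "y \<preceq> c i (g i) \<or> x \<preceq> c i (g i)" using bspec[OF F g] by auto
      have "g \<in> E" using g insert.prems by blast
      then have "g i \<in> {0,1}" unfolding E_def using i(1) by (rule PiE_mem)
      then have "c i (g i) \<in> carrier M" by (rule c[OF i(1)])
      then have "y' \<preceq> c i (g i) \<or> x' \<preceq> c i (g i)"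
        using i(2) le_trans[OF y'(2) _ y'(1) yx(1)] le_trans[OF x'(2) _ x'(1) yx(2)] by auto
      then show ?thesis using i(1) by (rule bexI)
    qed
    have "\<exists>y' x'. y' \<in> carrier M \<and> y' \<preceq> y \<and> x' \<in> carrier M \<and> x' \<preceq> x \<and> y' \<delta> x' \<and>
      (\<exists>i\<in>{1..n}. y' \<preceq> c i (f i) \<or> x' \<preceq> c i (f i))"
      using bspec[OF below f]
    proof
      assume "b \<preceq> ?s"
      then have "y \<preceq> ?s" using le_trans[OF yx(3)] yx b s by simp
      from additive_contact_plus_upto[OF assms cf yx(1,2,5) this]
      show ?thesis using yx(2) le_refl[OF yx(2)] by blast
    next
      assume "a \<preceq> ?s"
      then have le: "x \<preceq> ?s" using le_trans[OF yx(4)] yx a s by simp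
      have "x \<delta> y" using Sym[OF yx(1,2)] yx(5) by simp
      from additive_contact_plus_upto[OF assms cf yx(2,1) this le]
      obtain i x' where "i \<in> {1..n}" and x': "x' \<in> carrier M" "x' \<preceq> x" "x' \<preceq> c i (f i)" "x' \<delta> y"
        by blast
      moreover have "y \<delta> x'" using Sym[OF x'(1) yx(1)] x'(4) by simp
      ultimately show ?thesis using yx(1) le_refl[OF yx(1)] by blast
    qed
    then obtain y' x' where y': "y' \<in> carrier M" "y' \<preceq> y" and x': "x' \<in> carrier M" "x' \<preceq> x"
      and "y' \<delta> x'" and "\<exists>i\<in>{1..n}. y' \<preceq> c i (f i) \<or> x' \<preceq> c i (f i)" by blast
    moreover have "y' \<preceq> b" by (rule le_trans[OF y'(2) yx(3) y'(1) yx(1) b])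
    moreover have "x' \<preceq> a" by (rule le_trans[OF x'(2) yx(4) x'(1) yx(2) a])
    ultimately show ?case using keep[OF _ y' x'] by (intro exI[of _ y'] exI[of _ x']) simp
  qed
  obtain y x where yx: "y \<in> carrier M" "x \<in> carrier M" "y \<delta> x"
    and E: "\<forall>f\<in>E. \<exists>i\<in>{1..n}. y \<preceq> c i (f i) \<or> x \<preceq> c i (f i)"
    using shrink[OF \<open>finite E\<close>] by blast
  have nz: "y \<noteq> \<zero>" "x \<noteq> \<zero>" using Emp[OF yx] by (auto simp: less_order_of)
  have side: "\<exists>j\<in>{0,1}. \<not> y \<preceq> c i j \<and> \<not> x \<preceq> c i j" if i: "i \<in> {1..n}" for i
  proof (rule ccontr)
    assume "\<not> ?thesis"
    then have "y \<preceq> c i 0 \<or> x \<preceq> c i 0" "y \<preceq> c i 1 \<or> x \<preceq> c i 1" by auto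
    moreover have "c i 0 \<in> carrier M" "c i 1 \<in> carrier M" using c i by auto
    moreover have "y \<delta> y" "x \<delta> x" "x \<delta> y" using nz Ref yx Sym by auto
    ultimately have "c i 0 \<delta> c i 1" using Ext yx by meson
    then show False using nd i by blast
  qed
  then obtain g where g: "\<And>i. i \<in> {1..n} \<Longrightarrow> g i \<in> {0,1} \<and> \<not> y \<preceq> c i (g i) \<and> \<not> x \<preceq> c i (g i)"
    by metis
  have "restrict g {1..n} \<in> E" unfolding E_def using g by (auto simp: PiE_iff)
  then show False using E g by fastforce
qed

end

section \<open>Copies of powerset algebras\<close>

definition powerset_copy ::
  "('b set \<Rightarrow> 'a) \<Rightarrow> 'b set \<Rightarrow> ('b set \<Rightarrow> 'b set \<Rightarrow> bool) \<Rightarrow> 'a contact_structure" where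
  "powerset_copy i X R = (let g = inv_into (Pow X) i in
    \<lparr>carrier = i ` Pow X, cplus = \<lambda>x y. i (g x \<union> g y), czero = i {}, contact = \<lambda>x y. R (g x) (g y)\<rparr>)"

context
  fixes i :: "'b set \<Rightarrow> 'a" and X :: "'b set" and R :: "'b set \<Rightarrow> 'b set \<Rightarrow> bool"
  assumes i: "inj_on i (Pow X)"
begin

abbreviation (input) "copy \<equiv> powerset_copy i X R"

lemma carrier_copy: "carrier copy = i ` Pow X"
  by (simp add: powerset_copy_def Let_def)

lemma zero_copy: "\<zero>\<^bsub>copy\<^esub> = i {}"
  by (simp add: powerset_copy_def Let_def)

lemma plus_copy: "U \<subseteq> X \<Longrightarrow> V \<subseteq> X \<Longrightarrow> i U \<oplus>\<^bsub>copy\<^esub> i V = i (U \<union> V)"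
  by (simp add: powerset_copy_def Let_def inv_into_f_f[OF i])

lemma contact_copy: "U \<subseteq> X \<Longrightarrow> V \<subseteq> X \<Longrightarrow> i U \<delta>\<^bsub>copy\<^esub> i V \<longleftrightarrow> R U V"
  by (simp add: powerset_copy_def Let_def inv_into_f_f[OF i])

lemma eq_copy: "U \<subseteq> X \<Longrightarrow> V \<subseteq> X \<Longrightarrow> i U = i V \<longleftrightarrow> U = V"
  using i by (simp add: inj_on_eq_iff)

lemma le_copy: "U \<subseteq> X \<Longrightarrow> V \<subseteq> X \<Longrightarrow> i U \<preceq>\<^bsub>copy\<^esub> i V \<longleftrightarrow> U \<subseteq> V"
  by (simp add: le_order_of plus_copy eq_copy subset_Un_eq[symmetric] Un_least)

lemma semilattice_copy: "zero_semilattice copy"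
  by unfold_locales (auto simp: carrier_copy zero_copy plus_copy eq_copy Un_least intro!: arg_cong[of _ _ i])

lemma least_copy:
  assumes "U \<subseteq> X" "V \<subseteq> X"
  shows "least (order_of copy) (i (U \<union> V)) (Upper (order_of copy) {i U, i V})"
  using assms by (auto simp: least_def Upper_def carrier_copy le_copy Un_least)

lemma greatest_copy:
  assumes "U \<subseteq> X" "V \<subseteq> X"
  shows "greatest (order_of copy) (i (U \<inter> V)) (Lower (order_of copy) {i U, i V})"
  using assms by (auto simp: greatest_def Lower_def carrier_copy le_copy le_infI1)

lemma lattice_copy: "lattice (order_of copy)"
proof -
  interpret zero_semilattice copy by (rule semilattice_copy)
  have p: "partial_order (order_of copy)"
    by unfold_locales (auto intro: le_refl le_antisym le_trans)
  interpret partial_order "order_of copy" by (rule p)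
  show ?thesis
  proof (unfold_locales, goal_cases)
    case (1 x y)
    then show ?case using least_copy by (auto simp: carrier_copy)
  next
    case (2 x y)
    then show ?case using greatest_copy by (auto simp: carrier_copy)
  qed
qed

lemma meet_copy:
  assumes "U \<subseteq> X" "V \<subseteq> X"
  shows "i U \<sqinter>\<^bsub>order_of copy\<^esub> i V = i (U \<inter> V)"
proof -
  interpret lattice "order_of copy" by (rule lattice_copy)
  have "i U \<in> carrier copy" "i V \<in> carrier copy" using assms by (auto simp: carrier_copy)
  then show ?thesis
    using greatest_unique[OF _ greatest_copy[OF assms]]
    by (intro meetI[where P = "\<lambda>m. m = i (U \<inter> V)"]) auto
qed

lemma boolean_copy: "boolean_algebra_structure copy"
proof -
  interpret zero_semilattice copy by (rule semilattice_copy)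
  interpret L: lattice "order_of copy" by (rule lattice_copy)
  have bot: "least (order_of copy) (i {}) (carrier (order_of copy))"
    by (auto simp: least_def carrier_copy le_copy)
  have top: "greatest (order_of copy) (i X) (carrier (order_of copy))"
    by (auto simp: greatest_def carrier_copy le_copy)
  interpret L: bounded_lattice "order_of copy"
    by unfold_locales (use bot top in blast)+
  have top_eq: "\<top>\<^bsub>order_of copy\<^esub> = i X"
    using L.greatest_unique[OF L.top_greatest top] by simp
  show ?thesis
  proof (unfold_locales, goal_cases)
    case (1 a b c)
    then obtain U V W where "U \<subseteq> X" "V \<subseteq> X" "W \<subseteq> X" "a = i U" "b = i V" "c = i W"
      by (auto simp: carrier_copy)
    moreover then have "V \<union> W \<subseteq> X" "U \<inter> V \<subseteq> X" "U \<inter> W \<subseteq> X" by auto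
    ultimately show ?case by (simp add: meet_copy plus_copy Int_Un_distrib)
  next
    case (2 a)
    then obtain U where U: "U \<subseteq> X" "a = i U" by (auto simp: carrier_copy)
    then have "U \<union> (X - U) = X" by auto
    then show ?case using U
      by (intro bexI[of _ "i (X - U)"]) (auto simp: meet_copy plus_copy zero_copy top_eq carrier_copy)
  qed
qed

lemma overlap_copy:
  assumes "\<And>U V. U \<subseteq> X \<Longrightarrow> V \<subseteq> X \<Longrightarrow> R U V \<longleftrightarrow> U \<inter> V \<noteq> {}"
  shows "overlap_contact copy"
proof (unfold_locales, goal_cases)
  case (1 a b)
  then obtain U V where UV: "U \<subseteq> X" "V \<subseteq> X" "a = i U" "b = i V" by (auto simp: carrier_copy)
  have "(\<exists>n\<in>carrier copy. \<zero>\<^bsub>copy\<^esub> \<prec>\<^bsub>copy\<^esub> n \<and> n \<preceq>\<^bsub>copy\<^esub> a \<and> n \<preceq>\<^bsub>copy\<^esub> b) \<longleftrightarrow>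
      (\<exists>W\<in>Pow X. W \<noteq> {} \<and> W \<subseteq> U \<and> W \<subseteq> V)"
    using UV by (auto simp: carrier_copy zero_copy less_order_of le_copy eq_copy)
  also have "\<dots> \<longleftrightarrow> U \<inter> V \<noteq> {}"
    using UV by auto
  finally show ?case using UV assms by (simp add: contact_copy)
qed

lemma weak_contact_copy:
  assumes sym: "\<And>U V. R U V \<Longrightarrow> R V U"
    and emp: "\<And>U V. R U V \<Longrightarrow> U \<noteq> {}"
    and ext: "\<And>U V U' V'. \<lbrakk>R U V; U \<subseteq> U'; V \<subseteq> V'; U' \<subseteq> X; V' \<subseteq> X\<rbrakk> \<Longrightarrow> R U' V'"
    and ref: "\<And>U. \<lbrakk>U \<subseteq> X; U \<noteq> {}\<rbrakk> \<Longrightarrow> R U U"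
  shows "weak_contact copy"
proof (unfold_locales, goal_cases)
  case (1 a b)
  then show ?case using sym by (auto simp: carrier_copy contact_copy)
next
  case (2 a b)
  then obtain U V where UV: "U \<subseteq> X" "V \<subseteq> X" "a = i U" "b = i V" by (auto simp: carrier_copy)
  then have "R U V" using 2 by (simp add: contact_copy)
  then have "U \<noteq> {}" "V \<noteq> {}" using emp sym by blast+
  then show ?case using UV by (simp add: less_order_of zero_copy le_copy eq_copy eq_commute)
next
  case (3 a b a1 b1)
  then show ?case using ext by (auto simp: carrier_copy contact_copy le_copy)
next
  case (4 n)
  then show ?case using ref by (auto simp: carrier_copy contact_copy zero_copy eq_copy)
qed

end

section \<open>The representation of finite contact semilattices\<close>

text \<open>
  The ideals of a finite semilattice are principal. A point stands for the ideal of all elements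
  below \<open>s\<close>; the condition says that this ideal meets every pair of elements that are not in
  contact. As in Stone's representation, an element is mapped to the set of points whose ideal
  omits it. The ideals need not be prime; joins are preserved because an ideal contains a join iff
  it contains both of its terms.
\<close>

definition points :: "'a contact_structure \<Rightarrow> 'a set" where
  "points M = {s \<in> carrier M. \<forall>c0\<in>carrier M. \<forall>c1\<in>carrier M.
     \<not> c0 \<delta>\<^bsub>M\<^esub> c1 \<longrightarrow> c0 \<preceq>\<^bsub>M\<^esub> s \<or> c1 \<preceq>\<^bsub>M\<^esub> s}"

definition rep :: "'a contact_structure \<Rightarrow> 'a \<Rightarrow> 'a set" where
  "rep M a = {s \<in> points M. \<not> a \<preceq>\<^bsub>M\<^esub> s}"

lemma rep_subset: "rep M a \<subseteq> points M"
  by (auto simp: rep_def)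

context zero_semilattice
begin

lemma points_subset: "points M \<subseteq> carrier M"
  by (auto simp: points_def)

lemma rep_zero: "rep M \<zero> = {}"
  using points_subset zero_le by (auto simp: rep_def)

lemma rep_plus: "\<lbrakk>a \<in> carrier M; b \<in> carrier M\<rbrakk> \<Longrightarrow> rep M (a \<oplus> b) = rep M a \<union> rep M b"
  using points_subset by (auto simp: rep_def plus_le_iff subset_iff)

lemma contact_if_rep_intersect:
  "\<lbrakk>a \<in> carrier M; b \<in> carrier M; rep M a \<inter> rep M b \<noteq> {}\<rbrakk> \<Longrightarrow> a \<delta> b"
  by (auto simp: rep_def points_def)

text \<open>
  Let \<open>b\<close> not be below \<open>a\<close>, and let \<open>s\<close> be maximal among the elements above \<open>a\<close> that are not
  above \<open>b\<close>. If \<open>c0\<close> and \<open>c1\<close> are not in contact, then by (D1) one of them, say \<open>c\<close>, is such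
  that \<open>b\<close> is not below \<open>s \<oplus> c\<close>, and maximality puts this \<open>c\<close> below \<open>s\<close>. So \<open>s\<close> is a point, and
  it separates \<open>b\<close> from \<open>a\<close>.
\<close>

lemma le_if_rep_subset:
  assumes "finite (carrier M)" "D1 M" "a \<in> carrier M" "b \<in> carrier M" "rep M b \<subseteq> rep M a"
  shows "b \<preceq> a"
proof (rule ccontr)
  assume "\<not> b \<preceq> a"
  define A where "A = {s \<in> carrier M. a \<preceq> s \<and> \<not> b \<preceq> s}"
  have A: "a \<in> A" "finite A" "A \<subseteq> carrier M"
    using assms \<open>\<not> b \<preceq> a\<close> by (auto simp: A_def le_refl)
  have "\<exists>s\<in>A. \<forall>t\<in>A. \<not> s \<prec> t"
  proof -
    have "transp_on A (\<lambda>s t. s \<prec> t)"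
      unfolding less_order_of using A(3) le_trans le_antisym by (intro transp_onI) (meson subsetD)
    moreover have "asymp_on A (\<lambda>s t. s \<prec> t)"
      unfolding less_order_of using A(3) le_antisym by (intro asymp_onI) (meson subsetD)
    ultimately show ?thesis using Finite_Set.bex_max_element[of A "\<lambda>s t. s \<prec> t"] A
      by (metis empty_iff asymp_onD)
  qed
  then obtain s where s: "s \<in> carrier M" "a \<preceq> s" "\<not> b \<preceq> s"
    and max: "\<And>t. \<lbrakk>t \<in> carrier M; a \<preceq> t; \<not> b \<preceq> t; s \<preceq> t\<rbrakk> \<Longrightarrow> s = t"
    unfolding A_def less_order_of by blast
  have absorb: "c \<preceq> s" if "c \<in> carrier M" "\<not> b \<preceq> s \<oplus> c" for c
    using max[of "s \<oplus> c"] that s assms(3) le_trans le_plus_left le_plus_right plus_closed by metis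
  have "s \<in> points M"
    unfolding points_def
    using s absorb assms(2)[unfolded D1_def] assms(4) by blast
  then show False using s assms(5) by (auto simp: rep_def)
qed

lemma inj_on_rep: "\<lbrakk>finite (carrier M); D1 M\<rbrakk> \<Longrightarrow> inj_on (rep M) (carrier M)"
  by (intro inj_onI le_antisym le_if_rep_subset) auto

text \<open>
  There are only finitely many pairs of elements that are not in contact. If \<open>b \<delta> a\<close>, then (D2),
  applied to all of them at once, gives one member from each pair such that neither \<open>b\<close> nor \<open>a\<close>
  is below their sum \<open>s\<close>; this \<open>s\<close> is a point of both.
\<close>

lemma rep_intersect_if_contact:
  assumes "finite (carrier M)" "D2 M" "a \<in> carrier M" "b \<in> carrier M" "b \<delta> a"
  shows "rep M b \<inter> rep M a \<noteq> {}"
proof -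
  define P where "P = {(c0, c1). c0 \<in> carrier M \<and> c1 \<in> carrier M \<and> \<not> c0 \<delta> c1}"
  have "P \<subseteq> carrier M \<times> carrier M" by (auto simp: P_def)
  then have "finite P" using assms(1) by (meson finite_SigmaI finite_subset)
  then obtain h where "bij_betw h {0..<card P} P" using ex_bij_betw_nat_finite by blast
  moreover have "bij_betw (\<lambda>k. k - 1) {1..card P} {0..<card P}"
    by (rule bij_betwI[of _ _ _ Suc]) auto
  ultimately obtain q where q: "bij_betw q {1..card P} P"
    using bij_betw_trans by blast
  define n where "n = card P"
  define c where "c k j = (if j = (0::nat) then fst (q k) else snd (q k))" for k j
  have qP: "q k \<in> P" if "k \<in> {1..n}" for k
    using that q by (auto simp: n_def bij_betw_def)
  have c: "c k j \<in> carrier M" if "k \<in> {1..n}" for k j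
    using qP[OF that] by (auto simp: P_def c_def)
  have nd: "\<not> c k 0 \<delta> c k 1" if "k \<in> {1..n}" for k
    using qP[OF that] by (auto simp: P_def c_def)
  obtain f where f: "f \<in> {1..n} \<rightarrow> {0,1::nat}"
    and nle: "\<not> b \<preceq> plus_upto M (\<lambda>k. c k (f k)) n" "\<not> a \<preceq> plus_upto M (\<lambda>k. c k (f k)) n"
    using assms(2)[unfolded D2_def, rule_format, OF assms(3,4), of n c] c nd assms(5) by blast
  let ?s = "plus_upto M (\<lambda>k. c k (f k)) n"
  have s: "?s \<in> carrier M" using c by (rule plus_upto_closed)
  have "?s \<in> points M"
    unfolding points_def
  proof (intro CollectI conjI s ballI impI)
    fix c0 c1 assume "c0 \<in> carrier M" "c1 \<in> carrier M" "\<not> c0 \<delta> c1"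
    then have "(c0, c1) \<in> P" by (simp add: P_def)
    then obtain k where k: "k \<in> {1..n}" "q k = (c0, c1)"
      using q by (metis bij_betw_def imageE n_def)
    have "c k (f k) \<preceq> ?s" using le_plus_upto[of n "\<lambda>k. c k (f k)" k] c k(1) by blast
    moreover have "c k (f k) = c0 \<or> c k (f k) = c1" using k(2) by (simp add: c_def)
    ultimately show "c0 \<preceq> ?s \<or> c1 \<preceq> ?s" by auto
  qed
  then show ?thesis using nle by (auto simp: rep_def)
qed

lemma contact_embedding_copy:
  assumes "finite (carrier M)" "D1 M" and i: "inj_on i (Pow (points M))"
    and R: "\<And>a b. \<lbrakk>a \<in> carrier M; b \<in> carrier M\<rbrakk> \<Longrightarrow> R (rep M a) (rep M b) \<longleftrightarrow> a \<delta> b"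
  shows "contact_embedding M (powerset_copy i (points M) R) (i \<circ> rep M)"
proof (unfold_locales, goal_cases)
  case (1 a)
  then show ?case using rep_subset[of M a] by (auto simp: carrier_copy[OF i])
next
  case 2
  show ?case
    by (intro comp_inj_on[OF inj_on_rep[OF assms(1,2)]] inj_on_subset[OF i])
      (auto dest: subsetD[OF rep_subset])
next
  case 3
  then show ?case by (simp add: zero_copy[OF i] rep_zero)
next
  case (4 a b)
  then show ?case by (simp add: plus_copy[OF i] rep_plus rep_subset)
next
  case (5 a b)
  then show ?case by (simp add: contact_copy[OF i] R rep_subset)
qed

end

lemma inj_on_Pow_into_infinite:
  assumes "infinite (UNIV :: 'b set)" "finite X"
  obtains i :: "'a set \<Rightarrow> 'b" where "inj_on i (Pow X)"
proof -
  obtain T :: "'b set" where "finite T" "card T = card (Pow X)"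
    using infinite_arbitrarily_large[OF assms(1)] by blast
  then obtain i where "bij_betw i (Pow X) T"
    using finite_same_card_bij[of "Pow X" T] assms(2) by auto
  then show thesis using that by (auto simp: bij_betw_def)
qed

section \<open>Transfer of consequences\<close>

lemma consequence_SL_D1_D2_if_BA_overlap:
  assumes "universal \<phi>" "infinite (UNIV :: 'b set)"
    and BA: "logical_consequence (BA_overlap :: 'b contact_structure \<Rightarrow> bool) \<phi>"
  shows "logical_consequence (SL_D1_D2 :: 'a contact_structure \<Rightarrow> bool) \<phi>"
  unfolding logical_consequence_def
proof (intro allI impI, rule ccontr)
  fix M :: "'a contact_structure"
  assume M: "SL_D1_D2 M" "\<not> holds_in M \<phi>"
  obtain p where p: "quantifier_free p"
    and pa: "\<And>M :: 'a contact_structure. holds_in M \<phi> \<longleftrightarrow> holds_in M p"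
    and pb: "\<And>M :: 'b contact_structure. holds_in M \<phi> \<longleftrightarrow> holds_in M p"
    using universal_matrix[OF assms(1), where ?'a = 'a and ?'b = 'b] by blast
  obtain S where S: "finite S" "S \<subseteq> carrier M" "zero_semilattice (M\<lparr>carrier := S\<rparr>)"
    "\<not> holds_in (M\<lparr>carrier := S\<rparr>) p"
    using finite_refutation[of M p] M p pa unfolding SL_D1_D2_def by metis
  define N where "N = M\<lparr>carrier := S\<rparr>"
  interpret zero_semilattice N unfolding N_def by fact
  have N: "finite (carrier N)" "D1 N" "D2 N"
    using S M D1_restrict D2_restrict unfolding N_def SL_D1_D2_def by auto
  obtain i :: "'a set \<Rightarrow> 'b" where i: "inj_on i (Pow (points N))"
    using inj_on_Pow_into_infinite[OF assms(2)] finite_subset[OF points_subset N(1)] by metis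
  let ?R = "\<lambda>U V. U \<inter> V \<noteq> ({} :: 'a set)"
  have R: "?R (rep N a) (rep N b) \<longleftrightarrow> a \<delta>\<^bsub>N\<^esub> b" if "a \<in> carrier N" "b \<in> carrier N" for a b
    using contact_if_rep_intersect[OF that] rep_intersect_if_contact[OF N(1,3) that(2,1)] by blast
  interpret contact_embedding N "powerset_copy i (points N) ?R" "i \<circ> rep N"
    by (rule contact_embedding_copy[OF N(1,2) i R])
  have "BA_overlap (powerset_copy i (points N) ?R)"
    unfolding BA_overlap_def by (intro conjI boolean_copy[OF i] overlap_copy[OF i] refl)
  then have "holds_in (powerset_copy i (points N) ?R) p"
    using BA pb unfolding logical_consequence_def by blast
  then show False using holds_in_embedding[OF p] S(4) unfolding N_def by blast
qed

text \<open>
  Without (D2), elements in contact need not have intersecting images. The contact relation on the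
  powerset is therefore the least weak contact relation that contains the image of \<open>\<delta>\<close>. It adds
  no contact between images: intersecting images come from elements in contact, and the
  representation reflects the order, so the extensionality of \<open>\<delta>\<close> covers the rest.
\<close>

lemma consequence_SL_weak_D1_if_BA_weak:
  assumes "universal \<phi>" "infinite (UNIV :: 'b set)"
    and BA: "logical_consequence (BA_weak :: 'b contact_structure \<Rightarrow> bool) \<phi>"
  shows "logical_consequence (SL_weak_D1 :: 'a contact_structure \<Rightarrow> bool) \<phi>"
  unfolding logical_consequence_def
proof (intro allI impI, rule ccontr)
  fix M :: "'a contact_structure"
  assume M: "SL_weak_D1 M" "\<not> holds_in M \<phi>"
  obtain p where p: "quantifier_free p"
    and pa: "\<And>M :: 'a contact_structure. holds_in M \<phi> \<longleftrightarrow> holds_in M p"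
    and pb: "\<And>M :: 'b contact_structure. holds_in M \<phi> \<longleftrightarrow> holds_in M p"
    using universal_matrix[OF assms(1), where ?'a = 'a and ?'b = 'b] by blast
  obtain S where S: "finite S" "S \<subseteq> carrier M" "zero_semilattice (M\<lparr>carrier := S\<rparr>)"
    "\<not> holds_in (M\<lparr>carrier := S\<rparr>) p"
    using finite_refutation[of M p] M p pa unfolding SL_weak_D1_def by metis
  define N where "N = M\<lparr>carrier := S\<rparr>"
  interpret zero_semilattice N unfolding N_def by fact
  have N: "finite (carrier N)" "D1 N"
    using S M D1_restrict unfolding N_def SL_weak_D1_def by auto
  interpret weak_contact N
    using S M weak_contact_restrict unfolding N_def SL_weak_D1_def by auto
  obtain i :: "'a set \<Rightarrow> 'b" where i: "inj_on i (Pow (points N))"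
    using inj_on_Pow_into_infinite[OF assms(2)] finite_subset[OF points_subset N(1)] by metis
  define R where "R U V \<longleftrightarrow> U \<inter> V \<noteq> {} \<or>
    (\<exists>a\<in>carrier N. \<exists>b\<in>carrier N. a \<delta>\<^bsub>N\<^esub> b \<and> rep N a \<subseteq> U \<and> rep N b \<subseteq> V)" for U V
  have R: "R (rep N a) (rep N b) \<longleftrightarrow> a \<delta>\<^bsub>N\<^esub> b" if ab: "a \<in> carrier N" "b \<in> carrier N" for a b
  proof
    assume "R (rep N a) (rep N b)"
    then consider "rep N a \<inter> rep N b \<noteq> {}" |
        a' b' where "a' \<in> carrier N" "b' \<in> carrier N" "a' \<delta>\<^bsub>N\<^esub> b'"
          "rep N a' \<subseteq> rep N a" "rep N b' \<subseteq> rep N b"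
      unfolding R_def by blast
    then show "a \<delta>\<^bsub>N\<^esub> b"
    proof cases
      case 1
      then show ?thesis by (rule contact_if_rep_intersect[OF ab])
    next
      case 2
      then show ?thesis using Ext[OF 2(1,2) ab] le_if_rep_subset[OF N] ab by blast
    qed
  next
    assume "a \<delta>\<^bsub>N\<^esub> b"
    then show "R (rep N a) (rep N b)" unfolding R_def using ab by blast
  qed
  interpret contact_embedding N "powerset_copy i (points N) R" "i \<circ> rep N"
    by (rule contact_embedding_copy[OF N i R])
  have rep_nonempty: "rep N a \<noteq> {}" if "a \<in> carrier N" "a \<noteq> \<zero>\<^bsub>N\<^esub>" for a
    using le_if_rep_subset[OF N zero_closed that(1)] that le_zero_iff by auto
  have symR: "R V U" if "R U V" for U V
    using that Sym unfolding R_def by blast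
  have emp: "U \<noteq> {}" if "R U V" for U V
    using that Emp rep_nonempty unfolding R_def less_order_of by blast
  have extR: "R U' V'" if "R U V" "U \<subseteq> U'" "V \<subseteq> V'" "U' \<subseteq> points N" "V' \<subseteq> points N" for U V U' V'
    using that(1-3) unfolding R_def by blast
  have ref: "R U U" if "U \<subseteq> points N" "U \<noteq> {}" for U
    using that unfolding R_def by blast
  have "weak_contact (powerset_copy i (points N) R)"
    by (rule weak_contact_copy[where R = R, OF i symR emp extR ref])
  then have "BA_weak (powerset_copy i (points N) R)"
    unfolding BA_weak_def using boolean_copy[OF i] by simp
  then have "holds_in (powerset_copy i (points N) R) p"
    using BA pb unfolding logical_consequence_def by blast
  then show False using holds_in_embedding[OF p] S(4) unfolding N_def by blast
qed

lemma BA_overlap_le_DL_additive: "BA_overlap \<le> DL_additive"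
  unfolding BA_overlap_def DL_additive_def le_fun_def le_bool_def
  using boolean_algebra_structure.axioms(1) zero_distributive_lattice.additive_contact_if_overlap
  by blast

lemma DL_additive_le_SL_D1_D2: "DL_additive \<le> SL_D1_D2"
  unfolding DL_additive_def SL_D1_D2_def le_fun_def le_bool_def
  using zero_distributive_lattice.D1_if_weak_contact zero_distributive_lattice.D2_if_additive_contact
    zero_distributive_lattice.axioms(1) additive_contact.axioms(1) by blast

lemma BA_weak_le_DL_weak: "BA_weak \<le> DL_weak"
  unfolding BA_weak_def DL_weak_def le_fun_def le_bool_def
  using boolean_algebra_structure.axioms(1) by blast

lemma DL_weak_le_SL_weak_D1: "DL_weak \<le> SL_weak_D1"
  unfolding DL_weak_def SL_weak_D1_def le_fun_def le_bool_def
  using zero_distributive_lattice.D1_if_weak_contact zero_distributive_lattice.axioms(1) by blast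

lemma logical_consequence_mono:
  "T' \<le> T \<Longrightarrow> logical_consequence T \<phi> \<Longrightarrow> logical_consequence T' \<phi>"
  by (auto simp: logical_consequence_def)

theorem corollary5p1:
  fixes \<phi> :: cfm
  assumes "universal_sentence \<phi>"
    and "infinite (UNIV :: 'a set)" and "infinite (UNIV :: 'b set)" and "infinite (UNIV :: 'c set)"
    and "infinite (UNIV :: 'd set)" and "infinite (UNIV :: 'e set)" and "infinite (UNIV :: 'f set)"
  shows
    "((logical_consequence (BA_overlap :: 'a contact_structure \<Rightarrow> bool) \<phi> \<longleftrightarrow>
       logical_consequence (DL_additive :: 'b contact_structure \<Rightarrow> bool) \<phi>) \<and>
      (logical_consequence (DL_additive :: 'b contact_structure \<Rightarrow> bool) \<phi> \<longleftrightarrow>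
       logical_consequence (SL_D1_D2 :: 'c contact_structure \<Rightarrow> bool) \<phi>)) \<and>
     ((logical_consequence (BA_weak :: 'd contact_structure \<Rightarrow> bool) \<phi> \<longleftrightarrow>
       logical_consequence (DL_weak :: 'e contact_structure \<Rightarrow> bool) \<phi>) \<and>
      (logical_consequence (DL_weak :: 'e contact_structure \<Rightarrow> bool) \<phi> \<longleftrightarrow>
       logical_consequence (SL_weak_D1 :: 'f contact_structure \<Rightarrow> bool) \<phi>))"
proof -
  have u: "universal \<phi>" using assms(1) by (simp add: universal_sentence_def)
  note mono1 = logical_consequence_mono[OF BA_overlap_le_DL_additive]
    logical_consequence_mono[OF DL_additive_le_SL_D1_D2]
  note up1 = consequence_SL_D1_D2_if_BA_overlap[OF u]
  note mono2 = logical_consequence_mono[OF BA_weak_le_DL_weak]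
    logical_consequence_mono[OF DL_weak_le_SL_weak_D1]
  note up2 = consequence_SL_weak_D1_if_BA_weak[OF u]
  show ?thesis
  proof (intro conjI iffI)
    assume "logical_consequence (BA_overlap :: 'a contact_structure \<Rightarrow> bool) \<phi>"
    then show "logical_consequence (DL_additive :: 'b contact_structure \<Rightarrow> bool) \<phi>"
      by (rule mono1(2)[OF up1[OF assms(2)]])
  next
    assume "logical_consequence (DL_additive :: 'b contact_structure \<Rightarrow> bool) \<phi>"
    then show "logical_consequence (BA_overlap :: 'a contact_structure \<Rightarrow> bool) \<phi>"
      by (rule mono1(1)[OF mono1(2)[OF up1[OF assms(3) mono1(1)]]])
  next
    assume "logical_consequence (DL_additive :: 'b contact_structure \<Rightarrow> bool) \<phi>"
    then show "logical_consequence (SL_D1_D2 :: 'c contact_structure \<Rightarrow> bool) \<phi>"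
      by (rule up1[OF assms(3) mono1(1)])
  next
    assume "logical_consequence (SL_D1_D2 :: 'c contact_structure \<Rightarrow> bool) \<phi>"
    then show "logical_consequence (DL_additive :: 'b contact_structure \<Rightarrow> bool) \<phi>"
      by (rule mono1(2)[OF up1[OF assms(4) mono1(1)[OF mono1(2)]]])
  next
    assume "logical_consequence (BA_weak :: 'd contact_structure \<Rightarrow> bool) \<phi>"
    then show "logical_consequence (DL_weak :: 'e contact_structure \<Rightarrow> bool) \<phi>"
      by (rule mono2(2)[OF up2[OF assms(5)]])
  next
    assume "logical_consequence (DL_weak :: 'e contact_structure \<Rightarrow> bool) \<phi>"
    then show "logical_consequence (BA_weak :: 'd contact_structure \<Rightarrow> bool) \<phi>"
      by (rule mono2(1)[OF mono2(2)[OF up2[OF assms(6) mono2(1)]]])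
  next
    assume "logical_consequence (DL_weak :: 'e contact_structure \<Rightarrow> bool) \<phi>"
    then show "logical_consequence (SL_weak_D1 :: 'f contact_structure \<Rightarrow> bool) \<phi>"
      by (rule up2[OF assms(6) mono2(1)])
  next
    assume "logical_consequence (SL_weak_D1 :: 'f contact_structure \<Rightarrow> bool) \<phi>"
    then show "logical_consequence (DL_weak :: 'e contact_structure \<Rightarrow> bool) \<phi>"
      by (rule mono2(2)[OF up2[OF assms(7) mono2(1)[OF mono2(2)]]])
  qed
qed

end
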